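(* Let $p$ be a polynomial of degree three with complex coefficients and with noncollinear zeros $\lambda_1,\lambda_2,\lambda_3\in\mathbb{C}$. Then the critical points of $p$ are the foci of the unique ellipse inscribed in the triangle with vertices $\lambda_1,\lambda_2,\lambda_3$ that is tangent to the sides of the triangle at their midpoints.
   Context: The critical points of $p$ are the zeros of $p'$, listed with multiplicity. The complex plane is identified with $\mathbb{R}^2$. A circle is regarded as an ellipse whose two foci coincide with its center. *)

theory Defs
  imports "HOL-Analysis.Analysis" "HOL-Computational_Algebra.Computational_Algebra"
begin

definition critical_points :: "complex poly \<Rightarrow> complex multiset" where
  "critical_points p = proots (pderiv p)"

(* An ellipse is the curve itself, not the region it bounds. The strict inequality excludes
   the empty set and the segment joining the foci; circles are the case f1 = f2. Taking the
   foci as a multiset makes them unordered and counts the centre of a circle twice. *)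
definition ellipse_with_foci :: "complex set \<Rightarrow> complex multiset \<Rightarrow> bool" where
  "ellipse_with_foci E F \<longleftrightarrow>
     (\<exists>f1 f2 s. F = {#f1, f2#} \<and> dist f1 f2 < s \<and> E = {z. dist z f1 + dist z f2 = s})"

definition is_ellipse :: "complex set \<Rightarrow> bool" where
  "is_ellipse E \<longleftrightarrow> (\<exists>F. ellipse_with_foci E F)"

(* The line L is tangent to the curve C at q: it passes through q in the direction of a
   nonzero velocity v of a path that stays in C near time 0, at which it passes through q. *)
definition tangent_line_at :: "complex set \<Rightarrow> complex set \<Rightarrow> complex \<Rightarrow> bool" where
  "tangent_line_at L C q \<longleftrightarrow>
     (\<exists>\<gamma> v. \<gamma> 0 = q \<and> (\<forall>\<^sub>F t in nhds (0::real). \<gamma> t \<in> C) \<and>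
        (\<gamma> has_vector_derivative v) (at 0) \<and> v \<noteq> 0 \<and>
        L = range (\<lambda>t::real. q + t *\<^sub>R v))"

definition tangent_to_side_at_midpoint :: "complex set \<Rightarrow> complex \<Rightarrow> complex \<Rightarrow> bool" where
  "tangent_to_side_at_midpoint E a b \<longleftrightarrow> tangent_line_at (affine hull {a, b}) E (midpoint a b)"

definition midpoint_inscribed_ellipse ::
    "complex set \<Rightarrow> complex \<Rightarrow> complex \<Rightarrow> complex \<Rightarrow> bool" where
  "midpoint_inscribed_ellipse E a b c \<longleftrightarrow>
     is_ellipse E \<and> E \<subseteq> convex hull {a, b, c} \<and>
     tangent_to_side_at_midpoint E a b \<and>
     tangent_to_side_at_midpoint E b c \<and>
     tangent_to_side_at_midpoint E c a"

end

theory Submission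
  imports Defs
begin

text \<open>
  Every triangle is the image of the equilateral triangle with vertices the cube roots of unity under
  a real affine map \<open>x \<mapsto> g + u x + v cnj x\<close>, and the triangle is nondegenerate only if \<open>|u| \<noteq> |v|\<close>. In
  these coordinates everything can be computed. The cubic with the given zeros is a multiple of
  \<open>(z - g)\<^sup>3 - 3 u v (z - g) - (u\<^sup>3 + v\<^sup>3)\<close>, so its critical points are \<open>g + c\<close> and \<open>g - c\<close> with \<open>c\<^sup>2 = u v\<close>
  (\<open>critical_points_real_affine\<close>). The incircle \<open>|x| = 1/2\<close> of the equilateral triangle touches its
  sides at their midpoints, and affine maps preserve midpoints, tangency and inclusion. Its image is
  the ellipse with foci \<open>g + c\<close> and \<open>g - c\<close> and sum of focal distances \<open>|u| + |v|\<close>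
  (\<open>focal_ellipse_eq_real_affine_circle\<close>). This gives existence.

  For uniqueness, an arbitrary ellipse, given by its foci and its sum of focal distances, satisfies a
  quadratic equation (\<open>focal_sum_imp_quadratic\<close>). If the ellipse touches the sides at their midpoints,
  the pulled-back equation vanishes to second order along each side of the equilateral triangle at its
  midpoint, and such a quadratic polynomial is a multiple of \<open>|x|\<^sup>2 - 1/4\<close>
  (\<open>quadratic_touching_equilateral_triangle\<close>). Comparing coefficients shows that the foci of this
  ellipse are \<open>g + c\<close> and \<open>g - c\<close> (\<open>focal_ellipse_touching_sides\<close>); the sum of the focal distances can
  then be read off at a midpoint. As the foci were arbitrary, the same argument shows that the curve has
  no second pair of foci.
\<close>

section \<open>The cube roots of unity\<close>

text \<open>
  A primitive cube root of unity. The set \<open>{1, omega, cnj omega}\<close> is the vertex set of the model equilateral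
  triangle; if \<open>\<zeta>\<close> runs through it, then \<open>- \<zeta> / 2\<close> runs through the midpoints of the sides, and the
  side with midpoint \<open>- \<zeta> / 2\<close> has direction \<open>\<i> * \<zeta>\<close> and endpoints \<open>omega * \<zeta>\<close> and \<open>cnj omega * \<zeta>\<close>.
\<close>
definition omega :: complex where
  "omega = Complex (- 1 / 2) (sqrt 3 / 2)"

lemma omega_square: "omega ^ 2 = cnj omega"
  by (simp add: omega_def complex_eq_iff power2_eq_square field_simps)

lemma omega_cnj: "omega * cnj omega = 1"
  by (simp add: omega_def complex_eq_iff field_simps)

lemma omega_sum: "1 + omega + cnj omega = 0"
  by (simp add: omega_def complex_eq_iff)

lemma omega_minus_cnj: "omega - cnj omega = \<i> * sqrt 3"
  by (simp add: omega_def complex_eq_iff)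

lemma norm_omega: "cmod omega = 1"
  by (simp add: omega_def cmod_def power_divide)

text \<open>
  The three cube roots of unity sum to zero, so the common value \<open>k\<close> is zero; then \<open>Z\<close> is orthogonal
  to two independent directions. This converts three real conditions, one for each side, into one
  complex equation.
\<close>
lemma vanishing_on_cube_roots:
  assumes "\<And>\<zeta>. \<zeta> \<in> {1, omega, cnj omega} \<Longrightarrow> Re (\<zeta> * Z) = k"
  shows "Z = 0" "k = 0"
proof -
  have *: "Re Z = k" "- Re Z / 2 - sqrt 3 / 2 * Im Z = k" "- Re Z / 2 + sqrt 3 / 2 * Im Z = k"
    using assms[of 1] assms[of omega] assms[of "cnj omega"] by (simp_all add: omega_def)
  then have "k = 0" "sqrt 3 * Im Z = 0" by argo+
  with * show "Z = 0" "k = 0" by (simp_all add: complex_eq_iff)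
qed

section \<open>Triangles as images of an equilateral triangle\<close>

text \<open>
  Every real affine map of the complex plane has this form, with linear part
  \<open>x \<mapsto> u x + v cnj x\<close> of determinant \<open>|u|\<^sup>2 - |v|\<^sup>2\<close>; hence the condition \<open>|u| \<noteq> |v|\<close> below
  says that the map is invertible. The linear part itself is \<^term>\<open>real_affine 0 u v\<close>.
\<close>
definition real_affine :: "complex \<Rightarrow> complex \<Rightarrow> complex \<Rightarrow> complex \<Rightarrow> complex" where
  "real_affine g u v x = g + u * x + v * cnj x"

lemma real_affine_split: "real_affine e u v x = e + real_affine 0 u v x"
  by (simp add: real_affine_def)

text \<open>
  Cramer's rule for the linear system formed by \<open>w = u x + v cnj x\<close> and its conjugate.
\<close>
lemma real_affine_surj:
  assumes "cmod u \<noteq> cmod v"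
  obtains x where "z = real_affine g u v x"
proof
  let ?D = "complex_of_real ((cmod u)\<^sup>2 - (cmod v)\<^sup>2)" and ?w = "z - g"
  have "?D \<noteq> 0" using assms unfolding of_real_eq_0_iff by (simp add: power2_eq_iff_nonneg)
  have D: "?D = u * cnj u - v * cnj v" by (simp add: complex_norm_square del: of_real_power)
  let ?x = "(cnj u * ?w - v * cnj ?w) / ?D"
  have "cnj ?x = (u * cnj ?w - cnj v * ?w) / ?D" by simp
  then have "u * ?x + v * cnj ?x = (u * (cnj u * ?w - v * cnj ?w) + v * (u * cnj ?w - cnj v * ?w)) / ?D"
    by (simp only: add_divide_distrib times_divide_eq_right)
  also have "u * (cnj u * ?w - v * cnj ?w) + v * (u * cnj ?w - cnj v * ?w) = ?D * ?w"
    unfolding D by (simp add: algebra_simps)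
  finally have "u * ?x + v * cnj ?x = ?w" by (simp only: nonzero_mult_div_cancel_left[OF \<open>?D \<noteq> 0\<close>])
  then show "z = real_affine g u v ?x"
    unfolding real_affine_def add.assoc by (metis add.commute diff_add_cancel)
qed

text \<open>
  The coefficients are the discrete Fourier transform of the triple of vertices.
\<close>
lemma triangle_eq_real_affine_image:
  obtains g u v where "z1 = real_affine g u v 1" "z2 = real_affine g u v omega"
    "z3 = real_affine g u v (cnj omega)"
proof
  let ?g = "(z1 + z2 + z3) / 3" and ?u = "(z1 + cnj omega * z2 + omega * z3) / 3"
    and ?v = "(z1 + omega * z2 + cnj omega * z3) / 3"
  show "z1 = real_affine ?g ?u ?v 1" "z2 = real_affine ?g ?u ?v omega"
    "z3 = real_affine ?g ?u ?v (cnj omega)"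
    by (simp_all add: real_affine_def omega_def complex_eq_iff field_simps)
qed

text \<open>
  If \<open>|u| = |v|\<close>, then with \<open>u = a\<^sup>2\<close> and \<open>v = b\<^sup>2\<close> also \<open>|a| = |b|\<close>, and unless both
  are zero, \<open>b / a\<close> is the conjugate of \<open>a / b\<close>. Hence every value of the linear part is a real multiple of \<open>a b\<close>.
\<close>
lemma noncollinear_imp_norm_neq:
  assumes "\<not> collinear {real_affine g u v 1, real_affine g u v omega, real_affine g u v (cnj omega)}"
  shows "cmod u \<noteq> cmod v"
proof
  assume eq: "cmod u = cmod v"
  define a b where "a = csqrt u" and "b = csqrt v"
  have ab: "u = a\<^sup>2" "v = b\<^sup>2" by (simp_all add: a_def b_def)
  with eq have n: "cmod a = cmod b" by (simp add: norm_power power2_eq_iff_nonneg)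
  have param: "\<exists>t. real_affine g u v x = g + t *\<^sub>R (a * b)" for x
  proof (cases "b = 0")
    case True
    then show ?thesis using n ab by (simp add: real_affine_def)
  next
    case False
    have "a * cnj a = b * cnj b" using n by (metis complex_norm_square)
    then have "u * x + v * cnj x = (a / b * x + cnj (a / b * x)) * (a * b)"
      using False n unfolding ab by (simp add: field_simps power2_eq_square)
    also have "\<dots> = (2 * Re (a / b * x)) *\<^sub>R (a * b)"
      by (simp only: complex_add_cnj scaleR_conv_of_real)
    finally show ?thesis unfolding real_affine_def add.assoc by metis
  qed
  have "collinear (range (real_affine g u v))"
    unfolding collinear_def
  proof (intro exI[of _ "a * b"] ballI)
    fix x y assume "x \<in> range (real_affine g u v)" "y \<in> range (real_affine g u v)"
    then obtain s t where "x = g + s *\<^sub>R (a * b)" "y = g + t *\<^sub>R (a * b)" using param by blast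
    then show "\<exists>c. x - y = c *\<^sub>R (a * b)" by (intro exI[of _ "s - t"]) (simp add: algebra_simps)
  qed
  then have "collinear {real_affine g u v 1, real_affine g u v omega, real_affine g u v (cnj omega)}"
    by (rule collinear_subset) auto
  with assms show False by blast
qed

text \<open>
  The model disc lies in the model triangle because the barycentric coordinate of \<open>x\<close> at the vertex \<open>\<zeta>\<close>
  is \<open>(1 + 2 Re (x cnj \<zeta>)) / 3\<close>, which is nonnegative for \<open>|x| \<le> 1/2\<close>; affine maps preserve
  barycentric coordinates.
\<close>
lemma real_affine_disc_subset_triangle:
  assumes "cmod x \<le> 1 / 2"
  shows "real_affine g u v x \<in>
    convex hull {real_affine g u v 1, real_affine g u v omega, real_affine g u v (cnj omega)}"
proof -
  define w where "w \<zeta> = (1 + 2 * Re (x * cnj \<zeta>)) / 3" for \<zeta>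
  have w: "0 \<le> w \<zeta>" if "cmod \<zeta> = 1" for \<zeta>
  proof -
    have "\<bar>Re (x * cnj \<zeta>)\<bar> \<le> cmod x" using abs_Re_le_cmod[of "x * cnj \<zeta>"] that by (simp add: norm_mult)
    then show ?thesis using assms by (simp add: w_def)
  qed
  have sum: "w 1 + w omega + w (cnj omega) = 1" by (simp add: w_def omega_def field_simps)
  have x: "x = w 1 *\<^sub>R 1 + w omega *\<^sub>R omega + w (cnj omega) *\<^sub>R cnj omega"
    by (simp add: w_def omega_def complex_eq_iff field_simps)
  have "real_affine g u v x = real_affine ((w 1 + w omega + w (cnj omega)) *\<^sub>R g) u v
      (w 1 *\<^sub>R 1 + w omega *\<^sub>R omega + w (cnj omega) *\<^sub>R cnj omega)"
    unfolding sum x[symmetric] by simp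
  also have "\<dots> = w 1 *\<^sub>R real_affine g u v 1 + w omega *\<^sub>R real_affine g u v omega
      + w (cnj omega) *\<^sub>R real_affine g u v (cnj omega)"
    by (simp add: real_affine_def scaleR_conv_of_real algebra_simps)
  finally show ?thesis
    unfolding convex_hull_3 using w[of 1] w[of omega] w[of "cnj omega"] sum norm_omega by auto
qed

lemma midpoint_real_affine:
  "midpoint (real_affine g u v (omega * \<zeta>)) (real_affine g u v (cnj omega * \<zeta>)) = real_affine g u v (- \<zeta> / 2)"
proof -
  have "midpoint (real_affine g u v x) (real_affine g u v y) = real_affine g u v ((x + y) / 2)" for x y
    by (simp add: midpoint_def real_affine_def scaleR_conv_of_real field_simps)
  moreover have "omega * \<zeta> + cnj omega * \<zeta> = - \<zeta>"
    using omega_sum by (metis add.assoc distrib_right minus_unique mult_1 mult_zero_left)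
  ultimately show ?thesis by metis
qed

lemma side_direction_real_affine:
  "real_affine g u v (omega * \<zeta>) - real_affine g u v (cnj omega * \<zeta>) = sqrt 3 *\<^sub>R real_affine 0 u v (\<i> * \<zeta>)"
proof -
  have "omega = cnj omega + \<i> * sqrt 3" using omega_minus_cnj by (simp add: algebra_simps)
  then have "omega * \<zeta> = cnj omega * \<zeta> + \<i> * sqrt 3 * \<zeta>" by (metis distrib_right)
  then show ?thesis unfolding real_affine_def scaleR_conv_of_real
    by (simp add: algebra_simps)
qed

text \<open>
  Indexing the sides by the cube roots of unity allows all three tangency conditions to be treated at
  once. The side opposite to the vertex at \<open>\<zeta>\<close> is the one with endpoints at \<open>omega * \<zeta>\<close> and
  \<open>cnj omega * \<zeta>\<close>.
\<close>
lemma midpoint_inscribed_ellipse_real_affine: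
  "midpoint_inscribed_ellipse E (real_affine g u v 1) (real_affine g u v omega) (real_affine g u v (cnj omega))
    \<longleftrightarrow> is_ellipse E
      \<and> E \<subseteq> convex hull {real_affine g u v 1, real_affine g u v omega, real_affine g u v (cnj omega)}
      \<and> (\<forall>\<zeta>\<in>{1, omega, cnj omega}. tangent_to_side_at_midpoint E
            (real_affine g u v (omega * \<zeta>)) (real_affine g u v (cnj omega * \<zeta>)))"
proof -
  have "omega * omega = cnj omega" "cnj omega * cnj omega = omega" "cnj omega * omega = 1"
    using omega_square omega_cnj by (simp_all add: power2_eq_square mult.commute flip: complex_cnj_mult)
  then show ?thesis by (auto simp: midpoint_inscribed_ellipse_def omega_cnj)
qed

section \<open>Quadratic forms on the complex plane\<close>

text \<open>
  Every real symmetric bilinear form on the complex plane is of this shape. The quadratic form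
  \<open>\<alpha> |w|\<^sup>2 - 2 Re (cnj C w\<^sup>2)\<close> is chosen because for \<open>\<alpha> = s\<^sup>2 - 2 |c|\<^sup>2\<close> and \<open>C = c\<^sup>2\<close>, where
  \<open>2 |c| < s\<close>, one of its level curves is the ellipse with foci \<open>c\<close> and \<open>- c\<close> and sum of focal
  distances \<open>s\<close>: the parameter \<open>C\<close> carries the foci.
\<close>
definition polar_form :: "real \<Rightarrow> complex \<Rightarrow> complex \<Rightarrow> complex \<Rightarrow> real" where
  "polar_form \<alpha> C w z = \<alpha> * Re (cnj w * z) - 2 * Re (cnj C * w * z)"

lemma polar_form_add_left: "polar_form \<alpha> C (w + w') z = polar_form \<alpha> C w z + polar_form \<alpha> C w' z"
  by (simp add: polar_form_def algebra_simps)

lemma polar_form_add_right: "polar_form \<alpha> C w (z + z') = polar_form \<alpha> C w z + polar_form \<alpha> C w z'"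
  by (simp add: polar_form_def algebra_simps)

lemma polar_form_scaleR_right: "polar_form \<alpha> C w (r *\<^sub>R z) = r * polar_form \<alpha> C w z"
  by (simp add: polar_form_def algebra_simps)

lemma polar_form_commute: "polar_form \<alpha> C w z = polar_form \<alpha> C z w"
  by (simp add: polar_form_def algebra_simps)

lemma polar_form_diagonal: "polar_form \<alpha> C w w = \<alpha> * (cmod w)\<^sup>2 - 2 * Re (cnj C * w\<^sup>2)"
  unfolding polar_form_def cmod_power2 by (simp add: power2_eq_square algebra_simps)

definition polar_gradient :: "real \<Rightarrow> complex \<Rightarrow> complex \<Rightarrow> complex" where
  "polar_gradient \<alpha> C e = of_real \<alpha> * cnj e - 2 * cnj C * e"

lemma polar_form_eq_gradient: "polar_form \<alpha> C e z = Re (polar_gradient \<alpha> C e * z)"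
  by (simp add: polar_form_def polar_gradient_def algebra_simps)

text \<open>
  The condition \<open>\<alpha> > 2 |C|\<close> makes the form positive definite, hence nondegenerate.
\<close>
lemma polar_gradient_eq_0:
  assumes "polar_gradient \<alpha> C e = 0" "\<alpha> > 2 * cmod C"
  shows "e = 0"
proof (rule ccontr)
  assume "e \<noteq> 0"
  have "of_real \<alpha> * cnj e = 2 * cnj C * e" using assms(1) by (simp add: polar_gradient_def)
  then have "cmod (of_real \<alpha> * cnj e) = cmod (2 * cnj C * e)" by simp
  then have "\<bar>\<alpha>\<bar> = 2 * cmod C" using \<open>e \<noteq> 0\<close> by (simp add: norm_mult)
  with assms(2) show False by simp
qed

lemma of_real_2_Re: "of_real (2 * Re z) = z + cnj z"
  by (simp add: complex_add_cnj)

lemma polar_form_linear_right: "polar_form \<alpha> C e (real_affine 0 u v y)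
  = Re ((u * polar_gradient \<alpha> C e + cnj v * cnj (polar_gradient \<alpha> C e)) * y)"
  by (simp add: polar_form_eq_gradient real_affine_def algebra_simps)

text \<open>
  Pulling the form back along a linear map again gives a form of the same type. Over the reals the
  expansion is unwieldy, so both sides are doubled and written as polynomials in the variables and
  their conjugates.
\<close>
lemma polar_form_linear:
  "polar_form \<alpha> C (real_affine 0 u v x) (real_affine 0 u v y)
    = (\<alpha> * ((cmod u)\<^sup>2 + (cmod v)\<^sup>2) - 4 * Re (cnj C * u * v)) * Re (cnj x * y)
      + Re (2 * (of_real \<alpha> * u * cnj v - cnj C * u\<^sup>2 - C * (cnj v)\<^sup>2) * (x * y))" (is "?l = ?r")
proof -
  have l: "complex_of_real (2 * ?l)
    = \<alpha> * (cnj (u * x + v * cnj x) * (u * y + v * cnj y) + (u * x + v * cnj x) * cnj (u * y + v * cnj y))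
     - 2 * (cnj C * (u * x + v * cnj x) * (u * y + v * cnj y)
          + C * cnj (u * x + v * cnj x) * cnj (u * y + v * cnj y))"
  proof -
    have "complex_of_real (2 * ?l) = of_real \<alpha> * of_real (2 * Re (cnj (u * x + v * cnj x) * (u * y + v * cnj y)))
       - 2 * of_real (2 * Re (cnj C * (u * x + v * cnj x) * (u * y + v * cnj y)))"
      by (simp add: polar_form_def real_affine_def)
    then show ?thesis unfolding of_real_2_Re by simp
  qed
  have r: "complex_of_real (2 * ?r)
     = (\<alpha> * (u * cnj u + v * cnj v) - 2 * (cnj C * u * v + C * cnj u * cnj v)) * (cnj x * y + x * cnj y)
      + 2 * ((\<alpha> * u * cnj v - cnj C * u\<^sup>2 - C * (cnj v)\<^sup>2) * (x * y)
         + (\<alpha> * cnj u * v - C * (cnj u)\<^sup>2 - cnj C * v\<^sup>2) * (cnj x * cnj y))"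
  proof -
    have "complex_of_real (2 * ?r) = (of_real \<alpha> * (of_real ((cmod u)\<^sup>2) + of_real ((cmod v)\<^sup>2))
         - 2 * of_real (2 * Re (cnj C * u * v))) * of_real (2 * Re (cnj x * y))
       + of_real (2 * Re (2 * (of_real \<alpha> * u * cnj v - cnj C * u\<^sup>2 - C * (cnj v)\<^sup>2) * (x * y)))"
      by simp
    then show ?thesis unfolding of_real_2_Re complex_norm_square by (simp add: algebra_simps)
  qed
  have "complex_of_real (2 * ?l) = complex_of_real (2 * ?r)"
    unfolding l r by (simp add: power2_eq_square algebra_simps)
  then have "2 * ?l = 2 * ?r" by (simp only: of_real_eq_iff)
  then show ?thesis by (metis mult_left_cancel zero_neq_numeral)
qed

text \<open>
  The value of the pulled-back quadratic form is a quadratic polynomial in \<open>x\<close> with a constant term,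
  a linear part, an isotropic part \<open>|x|\<^sup>2\<close> and an anisotropic part \<open>Re (\<delta> x\<^sup>2)\<close>. It
  depends on \<open>|x|\<close> alone exactly if the linear and the anisotropic part vanish.
\<close>
lemma polar_form_real_affine:
  "polar_form \<alpha> C (real_affine e u v x) (real_affine e u v x)
    = polar_form \<alpha> C e e + 2 * Re ((u * polar_gradient \<alpha> C e + cnj v * cnj (polar_gradient \<alpha> C e)) * x)
      + (\<alpha> * ((cmod u)\<^sup>2 + (cmod v)\<^sup>2) - 4 * Re (cnj C * u * v)) * (cmod x)\<^sup>2
      + Re (2 * (of_real \<alpha> * u * cnj v - cnj C * u\<^sup>2 - C * (cnj v)\<^sup>2) * x\<^sup>2)"
proof -
  have 1: "Re (cnj x * x) = (cmod x)\<^sup>2" unfolding cmod_power2 by (simp add: power2_eq_square)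
  have "polar_form \<alpha> C (real_affine e u v x) (real_affine e u v x) = polar_form \<alpha> C e e
      + 2 * polar_form \<alpha> C e (real_affine 0 u v x) + polar_form \<alpha> C (real_affine 0 u v x) (real_affine 0 u v x)"
    unfolding real_affine_split[of e]
    by (simp add: polar_form_add_left polar_form_add_right polar_form_commute[of _ _ "real_affine 0 u v x" e])
  then show ?thesis
    unfolding polar_form_linear_right[of _ _ e] polar_form_linear 1 by (simp add: power2_eq_square)
qed

text \<open>
  Half the derivative of the polynomial in the preceding lemma, at \<open>x\<close> in direction \<open>y\<close>.
\<close>
lemma polar_form_real_affine_direction:
  "polar_form \<alpha> C (real_affine e u v x) (real_affine 0 u v y)
    = Re ((u * polar_gradient \<alpha> C e + cnj v * cnj (polar_gradient \<alpha> C e)) * y)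
      + (\<alpha> * ((cmod u)\<^sup>2 + (cmod v)\<^sup>2) - 4 * Re (cnj C * u * v)) * Re (cnj x * y)
      + Re (2 * (of_real \<alpha> * u * cnj v - cnj C * u\<^sup>2 - C * (cnj v)\<^sup>2) * (x * y))"
  unfolding real_affine_split[of e] polar_form_add_left polar_form_linear polar_form_linear_right[of _ _ e] by linarith

section \<open>The ellipse as the image of a circle\<close>

lemma parallelogram_law: "(cmod (x + y))\<^sup>2 + (cmod (x - y))\<^sup>2 = 2 * ((cmod x)\<^sup>2 + (cmod y)\<^sup>2)"
  unfolding cmod_power2 by (simp add: power2_eq_square algebra_simps)

text \<open>
  The parallelogram law gives the sum of the squares of the two focal distances and
  \<open>|w - c| |w + c| = |w\<^sup>2 - c\<^sup>2|\<close> gives their product; squaring once more removes the roots.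
\<close>
lemma focal_sum_imp_quadratic:
  fixes w c :: complex
  assumes "cmod (w - c) + cmod (w + c) = s"
  shows "polar_form (s\<^sup>2 - 2 * cmod (c\<^sup>2)) (c\<^sup>2) w w
    = s\<^sup>2 * (s\<^sup>2 - 4 * cmod (c\<^sup>2)) / 4"
proof -
  have par: "(cmod (w - c))\<^sup>2 + (cmod (w + c))\<^sup>2 = 2 * (cmod w)\<^sup>2 + 2 * (cmod c)\<^sup>2"
    using parallelogram_law[of w c] by simp
  have "cmod (w\<^sup>2 - c\<^sup>2) = cmod (w - c) * cmod (w + c)"
    by (simp add: power2_eq_square square_diff_square_factored norm_mult mult.commute)
  then have prod: "cmod (w\<^sup>2 - c\<^sup>2) = s\<^sup>2 / 2 - (cmod w)\<^sup>2 - (cmod c)\<^sup>2"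
    using par unfolding assms[symmetric] by (simp add: power2_sum field_simps)
  have "(cmod (w\<^sup>2 - c\<^sup>2))\<^sup>2 = ((cmod w)\<^sup>2)\<^sup>2 + ((cmod c)\<^sup>2)\<^sup>2 - 2 * Re (cnj (c\<^sup>2) * w\<^sup>2)"
    unfolding cmod_power2 by (simp add: power2_eq_square algebra_simps)
  then show ?thesis unfolding prod norm_power polar_form_diagonal
    by (simp add: power2_eq_square field_simps)
qed

text \<open>
  Writing \<open>x = \<eta>\<^sup>2 / 2\<close> with \<open>|\<eta>| = 1\<close> makes the two focal vectors perfect squares,
  \<open>(a \<eta> \<plusminus> b cnj \<eta>)\<^sup>2 / 2\<close>, whose lengths have the sum \<open>|a|\<^sup>2 + |b|\<^sup>2\<close> by the parallelogram law. Hence the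
  image of the circle lies on the ellipse. Conversely, a point of the ellipse is the image of some
  \<open>x\<close>, and the quadratic equation of the ellipse, pulled back, forces \<open>|x| = 1/2\<close>.
\<close>
lemma focal_ellipse_eq_real_affine_circle:
  fixes g a b :: complex
  defines "u \<equiv> a\<^sup>2" and "v \<equiv> b\<^sup>2"
  assumes ne: "cmod u \<noteq> cmod v"
  shows "{z. dist z (g + a * b) + dist z (g - a * b) = cmod u + cmod v}
    = real_affine g u v ` sphere 0 (1 / 2)"
proof (intro set_eqI iffI)
  fix z assume "z \<in> real_affine g u v ` sphere 0 (1 / 2)"
  then obtain x where x: "cmod x = 1 / 2" and z: "z = real_affine g u v x" by auto
  obtain \<eta> where \<eta>: "x = \<eta>\<^sup>2 / 2"
    using power2_csqrt[of "2 * x"] by (metis nonzero_mult_div_cancel_left zero_neq_numeral)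
  have "cmod (\<eta>\<^sup>2) = 2 * cmod x" unfolding \<eta> by (simp add: norm_divide)
  then have \<eta>n: "(cmod \<eta>)\<^sup>2 = 1" using x by (simp add: norm_power)
  then have \<eta>1: "\<eta> * cnj \<eta> = 1" by (metis complex_norm_square of_real_1)
  have "z - (g - a * b) = a\<^sup>2 * x + b\<^sup>2 * cnj x + a * b * (\<eta> * cnj \<eta>)"
    and "z - (g + a * b) = a\<^sup>2 * x + b\<^sup>2 * cnj x - a * b * (\<eta> * cnj \<eta>)"
    unfolding \<eta>1 z u_def v_def real_affine_def by simp_all
  then have "z - (g - a * b) = (a * \<eta> + b * cnj \<eta>)\<^sup>2 / 2"
    and "z - (g + a * b) = (a * \<eta> - b * cnj \<eta>)\<^sup>2 / 2"
    unfolding \<eta> by (simp_all add: power2_eq_square field_simps)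
  then have "dist z (g - a * b) + dist z (g + a * b)
      = cmod ((a * \<eta> + b * cnj \<eta>)\<^sup>2 / 2) + cmod ((a * \<eta> - b * cnj \<eta>)\<^sup>2 / 2)"
    unfolding dist_norm by (simp only:)
  also have "\<dots>
      = ((cmod (a * \<eta> + b * cnj \<eta>))\<^sup>2 + (cmod (a * \<eta> - b * cnj \<eta>))\<^sup>2) / 2"
    by (simp add: norm_divide norm_power add_divide_distrib)
  also have "\<dots> = (cmod (a * \<eta>))\<^sup>2 + (cmod (b * cnj \<eta>))\<^sup>2"
    by (simp add: parallelogram_law)
  also have "\<dots> = cmod u + cmod v"
    using \<eta>n by (simp add: u_def v_def norm_mult norm_power power_mult_distrib)
  finally show "z \<in> {z. dist z (g + a * b) + dist z (g - a * b) = cmod u + cmod v}" by simp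
next
  fix z assume "z \<in> {z. dist z (g + a * b) + dist z (g - a * b) = cmod u + cmod v}"
  then have sum: "cmod ((z - g) - a * b) + cmod ((z - g) + a * b) = cmod u + cmod v"
    by (simp add: dist_norm algebra_simps)
  obtain x where z: "z = real_affine g u v x" using real_affine_surj[OF ne] .
  define U V where "U = cmod u" and "V = cmod v"
  have C: "(a * b)\<^sup>2 = u * v" by (simp add: u_def v_def power_mult_distrib)
  have zg: "z - g = real_affine 0 u v x" by (simp add: z real_affine_def)
  have nu: "u * cnj u = of_real (U\<^sup>2)" and nv: "v * cnj v = of_real (V\<^sup>2)"
    unfolding U_def V_def complex_norm_square by simp_all
  have \<alpha>: "(U + V)\<^sup>2 - 2 * cmod (u * v) = U\<^sup>2 + V\<^sup>2"
    by (simp add: U_def V_def norm_mult power2_sum)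
  \<comment> \<open>With these parameters the form pulls back to a multiple of \<open>|x|\<^sup>2\<close>.\<close>
  have \<delta>: "of_real (U\<^sup>2 + V\<^sup>2) * u * cnj v - cnj (u * v) * u\<^sup>2 - (u * v) * (cnj v)\<^sup>2 = 0"
    unfolding of_real_add nu[symmetric] nv[symmetric] by (simp add: power2_eq_square algebra_simps)
  have \<rho>: "Re (cnj (u * v) * u * v) = U\<^sup>2 * V\<^sup>2"
  proof -
    have "cnj (u * v) * u * v = (u * cnj u) * (v * cnj v)" by (simp add: mult_ac)
    then show ?thesis unfolding nu nv by (simp flip: of_real_mult of_real_power)
  qed
  have "((U\<^sup>2 + V\<^sup>2) * (U\<^sup>2 + V\<^sup>2) - 4 * (U\<^sup>2 * V\<^sup>2)) * (cmod x)\<^sup>2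
      = (U + V)\<^sup>2 * ((U + V)\<^sup>2 - 4 * (U * V)) / 4"
    using focal_sum_imp_quadratic[OF sum]
    unfolding zg C polar_form_real_affine U_def[symmetric] V_def[symmetric] \<alpha> \<delta> \<rho>
    by (simp add: U_def V_def norm_mult polar_form_def polar_gradient_def)
  then have "(U\<^sup>2 - V\<^sup>2)\<^sup>2 * (cmod x)\<^sup>2 = (U\<^sup>2 - V\<^sup>2)\<^sup>2 * (1 / 2)\<^sup>2"
    by (simp add: power2_eq_square algebra_simps)
  moreover have "(U\<^sup>2 - V\<^sup>2)\<^sup>2 \<noteq> 0"
    using ne by (simp add: U_def V_def power2_eq_iff_nonneg)
  ultimately have "(cmod x)\<^sup>2 = (1 / 2)\<^sup>2" by (metis mult_left_cancel)
  then have "cmod x = 1 / 2" by (simp add: power2_eq_iff_nonneg)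
  then show "z \<in> real_affine g u v ` sphere 0 (1 / 2)" using z by auto
qed

section \<open>Tangency to the sides\<close>

lemma affine_hull_symmetric_pair:
  fixes m d :: "'a::real_vector"
  assumes "k \<noteq> 0"
  shows "affine hull {m - k *\<^sub>R d, m + k *\<^sub>R d} = range (\<lambda>t. m + t *\<^sub>R d)"
proof (intro set_eqI iffI)
  fix z assume "z \<in> affine hull {m - k *\<^sub>R d, m + k *\<^sub>R d}"
  then obtain t where "z = m - k *\<^sub>R d + t *\<^sub>R (m + k *\<^sub>R d - (m - k *\<^sub>R d))"
    by (auto simp: affine_hull_2_alt)
  then have "z = m + (2 * t * k - k) *\<^sub>R d" by (simp add: algebra_simps flip: scaleR_2)
  then show "z \<in> range (\<lambda>t. m + t *\<^sub>R d)" by blast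
next
  fix z assume "z \<in> range (\<lambda>t. m + t *\<^sub>R d)"
  then obtain t where z: "z = m + t *\<^sub>R d" by blast
  let ?r = "(1 + t / k) / 2"
  have "m - k *\<^sub>R d + ?r *\<^sub>R (m + k *\<^sub>R d - (m - k *\<^sub>R d)) = m + (2 * ?r * k - k) *\<^sub>R d"
    by (simp add: algebra_simps flip: scaleR_2)
  also have "2 * ?r * k - k = t" using assms by (simp add: field_simps)
  finally show "z \<in> affine hull {m - k *\<^sub>R d, m + k *\<^sub>R d}"
    unfolding z affine_hull_2_alt by (metis rangeI)
qed

text \<open>
  The image of the circular motion \<open>t \<mapsto> - \<zeta> / 2 * exp (\<i> t)\<close> is a path on the ellipse whose velocity
  at the midpoint is parallel to the side. The velocity is nonzero because the linear part is
  injective.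
\<close>
lemma tangent_to_sides_at_midpoints:
  assumes ne: "cmod u \<noteq> cmod v" and \<zeta>: "cmod \<zeta> = 1"
  shows "tangent_to_side_at_midpoint (real_affine g u v ` sphere 0 (1 / 2))
    (real_affine g u v (omega * \<zeta>)) (real_affine g u v (cnj omega * \<zeta>))"
  unfolding tangent_to_side_at_midpoint_def midpoint_real_affine tangent_line_at_def
proof (intro exI conjI)
  let ?T = "real_affine g u v" and ?d = "real_affine 0 u v (- \<i> * \<zeta> / 2)"
  let ?\<gamma> = "\<lambda>t. ?T (- \<zeta> / 2 * exp (\<i> * of_real t))"
  show "?\<gamma> 0 = ?T (- \<zeta> / 2)" by simp
  show "\<forall>\<^sub>F t in nhds 0. ?\<gamma> t \<in> ?T ` sphere 0 (1 / 2)"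
    using \<zeta> by (intro always_eventually allI imageI) (simp add: norm_mult norm_divide)
  have "((\<lambda>t. - \<zeta> / 2 * exp (\<i> * complex_of_real t)) has_vector_derivative - \<zeta> / 2 * (\<i> * 1)) (at 0)"
    by (auto intro!: derivative_eq_intros has_vector_derivative_real_field simp: field_simps)
  then have e: "((\<lambda>t. - \<zeta> / 2 * exp (\<i> * complex_of_real t)) has_vector_derivative - \<i> * \<zeta> / 2) (at 0)"
    by (simp add: mult.commute)
  have "((\<lambda>t. g + (u * (- \<zeta> / 2 * exp (\<i> * of_real t)) + v * cnj (- \<zeta> / 2 * exp (\<i> * of_real t))))
      has_vector_derivative 0 + (u * (- \<i> * \<zeta> / 2) + v * cnj (- \<i> * \<zeta> / 2))) (at 0)"
    by (intro has_vector_derivative_add has_vector_derivative_const has_vector_derivative_mult_right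
        bounded_linear.has_vector_derivative[OF bounded_linear_cnj] e)
  then show "(?\<gamma> has_vector_derivative ?d) (at 0)"
    unfolding real_affine_def add.assoc by (simp only: add_0_left)
  show "?d \<noteq> 0"
  proof
    assume "?d = 0"
    then have "cmod (u * (- \<i> * \<zeta> / 2)) = cmod (v * cnj (- \<i> * \<zeta> / 2))"
      unfolding real_affine_def by (metis add_0 add_eq_0_iff norm_minus_cancel)
    then show False using ne \<zeta> by (simp add: norm_mult norm_divide)
  qed
  show "affine hull {?T (omega * \<zeta>), ?T (cnj omega * \<zeta>)} = range (\<lambda>t. ?T (- \<zeta> / 2) + t *\<^sub>R ?d)"
  proof -
    let ?a = "?T (omega * \<zeta>)" and ?b = "?T (cnj omega * \<zeta>)"
    have "real_affine 0 u v (\<i> * \<zeta>) = (- 2) *\<^sub>R ?d"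
      by (simp add: real_affine_def scaleR_conv_of_real algebra_simps)
    then have "?a - ?b = - (2 * sqrt 3) *\<^sub>R ?d"
      by (simp add: side_direction_real_affine)
    moreover have "?a + ?b = 2 *\<^sub>R ?T (- \<zeta> / 2)"
      unfolding midpoint_real_affine[symmetric] midpoint_def by simp
    moreover have "x = m - k *\<^sub>R d \<and> y = m + k *\<^sub>R d"
      if "x - y = - (2 * k) *\<^sub>R d" "x + y = 2 *\<^sub>R m" for x y m d :: complex and k
      using that by (simp add: complex_eq_iff)
    ultimately have ab: "?a = ?T (- \<zeta> / 2) - sqrt 3 *\<^sub>R ?d" "?b = ?T (- \<zeta> / 2) + sqrt 3 *\<^sub>R ?d"
      by blast+
    show ?thesis unfolding ab by (rule affine_hull_symmetric_pair) simp
  qed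
qed

text \<open>
  Near time \<open>0\<close> the quadratic form is constant along the path that witnesses tangency, so its derivative
  vanishes in the direction of the velocity, which is the direction of the line.
\<close>
lemma tangent_line_at_quadratic_curve:
  assumes tan: "tangent_line_at (affine hull {a, b}) E m"
    and E: "\<And>z. z \<in> E \<Longrightarrow> polar_form \<alpha> C (z - h) (z - h) = N"
  shows "polar_form \<alpha> C (m - h) (m - h) = N" "polar_form \<alpha> C (m - h) (b - a) = 0"
proof -
  obtain \<gamma> v where \<gamma>: "\<gamma> 0 = m" "\<forall>\<^sub>F t in nhds (0::real). \<gamma> t \<in> E"
      "(\<gamma> has_vector_derivative v) (at 0)"
    and L: "affine hull {a, b} = range (\<lambda>t::real. m + t *\<^sub>R v)"
    using tan unfolding tangent_line_at_def by blast
  have "m \<in> E" using eventually_nhds_x_imp_x[OF \<gamma>(2)] \<gamma>(1) by simp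
  then show "polar_form \<alpha> C (m - h) (m - h) = N" by (rule E)
  have d: "((\<lambda>t. \<gamma> t - h) has_vector_derivative v) (at 0)"
    using \<gamma>(3) by (auto intro!: derivative_eq_intros)
  have Re_deriv: "((\<lambda>t. Re (f t)) has_vector_derivative Re f') (at 0)"
    if "(f has_vector_derivative f') (at 0)" for f :: "real \<Rightarrow> complex" and f'
    using bounded_linear.has_vector_derivative[OF bounded_linear_Re that] .
  have cnj_deriv: "((\<lambda>t. cnj (\<gamma> t - h)) has_vector_derivative cnj v) (at 0)"
    using bounded_linear.has_vector_derivative[OF bounded_linear_cnj d] .
  have "((\<lambda>t. polar_form \<alpha> C (\<gamma> t - h) (\<gamma> t - h)) has_vector_derivative
      \<alpha> * Re (cnj (\<gamma> 0 - h) * v + cnj v * (\<gamma> 0 - h))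
      - 2 * Re (cnj C * ((\<gamma> 0 - h) * v + v * (\<gamma> 0 - h)))) (at 0)"
    unfolding polar_form_def mult.assoc
    by (intro has_vector_derivative_diff has_vector_derivative_mult_right Re_deriv
        has_vector_derivative_mult cnj_deriv d)
  then have "((\<lambda>t. polar_form \<alpha> C (\<gamma> t - h) (\<gamma> t - h)) has_vector_derivative
      2 * polar_form \<alpha> C (m - h) v) (at 0)"
    by (rule back_subst[of "\<lambda>D. (_ has_vector_derivative D) _"])
      (simp add: \<gamma>(1) polar_form_def algebra_simps)
  moreover have "((\<lambda>t. polar_form \<alpha> C (\<gamma> t - h) (\<gamma> t - h)) has_vector_derivative 0) (at 0)"
  proof -
    have "\<forall>\<^sub>F t in nhds 0. N = polar_form \<alpha> C (\<gamma> t - h) (\<gamma> t - h)"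
      using \<gamma>(2) by eventually_elim (simp add: E)
    then have "\<forall>\<^sub>F t in at 0. N = polar_form \<alpha> C (\<gamma> t - h) (\<gamma> t - h)"
      and "N = polar_form \<alpha> C (\<gamma> 0 - h) (\<gamma> 0 - h)"
      using eventually_nhds_x_imp_x by (auto intro: eventually_at_filter[THEN iffD2] elim: eventually_mono)
    then show ?thesis
      unfolding has_vector_derivative_def
      using has_derivative_transform_eventually[of "\<lambda>_. N" _ 0 UNIV] by force
  qed
  ultimately have "polar_form \<alpha> C (m - h) v = 0"
    using vector_derivative_unique_at by fastforce
  moreover obtain t t' where "a = m + t *\<^sub>R v" "b = m + t' *\<^sub>R v"
    using L hull_inc[of a "{a, b}" affine] hull_inc[of b "{a, b}" affine] by (auto simp: image_iff)
  then have "b - a = (t' - t) *\<^sub>R v" by (simp add: algebra_simps)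
  ultimately show "polar_form \<alpha> C (m - h) (b - a) = 0" by (simp only: polar_form_scaleR_right)
qed

section \<open>Uniqueness of the foci\<close>

text \<open>
  The incircle of the equilateral triangle is the only conic through the midpoints of the sides that is
  tangent there to the sides: a quadratic polynomial that vanishes to second order along each side at
  its midpoint is the multiple \<open>\<rho> (|x|\<^sup>2 - 1/4)\<close> of the equation of the incircle. The hypotheses express
  this for the polynomial \<open>k + 2 Re (\<beta> x) + \<rho> |x|\<^sup>2 + Re (\<delta> x\<^sup>2)\<close>, by its value and half its derivative
  along the side.
\<close>
lemma quadratic_touching_equilateral_triangle:
  fixes \<beta> \<delta> :: complex and k \<rho> :: real
  assumes val: "\<And>\<zeta>. \<zeta> \<in> {1, omega, cnj omega} \<Longrightarrow>
      k + 2 * Re (\<beta> * (- \<zeta> / 2)) + \<rho> * (cmod (- \<zeta> / 2))\<^sup>2 + Re (\<delta> * (- \<zeta> / 2)\<^sup>2) = 0"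
    and der: "\<And>\<zeta>. \<zeta> \<in> {1, omega, cnj omega} \<Longrightarrow>
      Re (\<beta> * (\<i> * \<zeta>)) + \<rho> * Re (cnj (- \<zeta> / 2) * (\<i> * \<zeta>)) + Re (\<delta> * (- \<zeta> / 2 * (\<i> * \<zeta>))) = 0"
  shows "\<beta> = 0" "\<delta> = 0" "k = - \<rho> / 4"
proof -
  have sq: "\<zeta> * \<zeta> = cnj \<zeta>" and n: "cmod \<zeta> = 1" if "\<zeta> \<in> {1, omega, cnj omega}" for \<zeta>
    using that omega_square norm_omega by (auto simp flip: complex_cnj_mult simp: power2_eq_square)
  \<comment> \<open>As \<open>\<zeta>\<^sup>2 = cnj \<zeta>\<close>, both conditions are real linear in \<open>\<zeta>\<close>.\<close>
  have a: "Re (\<zeta> * (- \<beta> + cnj \<delta> / 4)) = - (k + \<rho> / 4)" if "\<zeta> \<in> {1, omega, cnj omega}" for \<zeta>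
  proof -
    have "(- \<zeta> / 2)\<^sup>2 = cnj \<zeta> / 4" using sq[OF that] by (simp add: power2_eq_square)
    then show ?thesis using val[OF that] n[OF that]
      by (simp add: norm_divide power2_eq_square field_simps)
  qed
  have b: "Re (\<zeta> * (\<i> * (\<beta> + cnj \<delta> / 2))) = 0" if "\<zeta> \<in> {1, omega, cnj omega}" for \<zeta>
  proof -
    have "- \<zeta> / 2 * (\<i> * \<zeta>) = - \<i> * cnj \<zeta> / 2" unfolding sq[OF that, symmetric] by simp
    moreover have "Re (cnj (- \<zeta> / 2) * (\<i> * \<zeta>)) = 0" by simp
    ultimately show ?thesis using der[OF that] by (simp add: field_simps)
  qed
  have "- \<beta> + cnj \<delta> / 4 = 0" "- (k + \<rho> / 4) = 0"
    using vanishing_on_cube_roots[OF a] by blast+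
  moreover have "\<beta> + cnj \<delta> / 2 = 0" using vanishing_on_cube_roots(1)[OF b] by simp
  ultimately have "cnj \<delta> = 0" "\<beta> = 0" "k = - \<rho> / 4"
    by (auto simp: complex_eq_iff)
  then show "\<beta> = 0" "\<delta> = 0" "k = - \<rho> / 4" by auto
qed

text \<open>
  The hypothesis \<open>circ\<close> says that the form with parameters \<open>\<alpha>\<close> and \<open>C\<close> pulls back to a multiple of
  \<open>|x|\<^sup>2\<close>; this determines the pair \<open>(\<alpha>, C)\<close> up to a real factor \<open>r\<close>. The hypothesis \<open>size\<close> compares
  the levels of the two curves; its left-hand side is quadratic and its right-hand side linear in
  \<open>r\<close>, which leaves \<open>r = 1\<close>, as \<open>\<alpha> > 0\<close> excludes \<open>r = 0\<close>.
\<close>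
lemma focal_parameter_unique:
  fixes u v C :: complex and \<alpha> :: real
  assumes ne: "cmod u \<noteq> cmod v" and pos: "\<alpha> > 0"
    and circ: "of_real \<alpha> * u * cnj v = cnj C * u\<^sup>2 + C * (cnj v)\<^sup>2"
    and size: "\<alpha>\<^sup>2 - 4 * (cmod C)\<^sup>2 = \<alpha> * ((cmod u)\<^sup>2 + (cmod v)\<^sup>2) - 4 * Re (cnj C * u * v)"
  shows "C = u * v"
proof (cases "u = 0 \<or> v = 0")
  case True
  then show ?thesis using circ ne by auto
next
  case False
  define U V where "U = cmod u" and "V = cmod v"
  have nu: "u * cnj u = of_real (U\<^sup>2)" and nv: "v * cnj v = of_real (V\<^sup>2)"
    unfolding U_def V_def complex_norm_square by simp_all
  define \<kappa> where "\<kappa> = C / (u * v)"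
  have C: "C = \<kappa> * (u * v)" using False by (simp add: \<kappa>_def)
  have "of_real \<alpha> * (u * cnj v) = (cnj \<kappa> * (u * cnj u) + \<kappa> * (v * cnj v)) * (u * cnj v)"
    using circ unfolding C by (simp add: power2_eq_square algebra_simps)
  then have \<alpha>: "of_real \<alpha> = cnj \<kappa> * of_real (U\<^sup>2) + \<kappa> * of_real (V\<^sup>2)"
    using False unfolding nu nv mult_cancel_right by simp
  \<comment> \<open>The imaginary part shows that the factor \<open>\<kappa>\<close> is real, as \<open>|u| \<noteq> |v|\<close>.\<close>
  have "Im (cnj \<kappa> * of_real (U\<^sup>2) + \<kappa> * of_real (V\<^sup>2)) = Im \<kappa> * (V\<^sup>2 - U\<^sup>2)"
    by (simp add: algebra_simps del: of_real_power)
  then have "Im \<kappa> * (V\<^sup>2 - U\<^sup>2) = 0" unfolding \<alpha>[symmetric] by (metis Im_complex_of_real)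
  moreover have "V\<^sup>2 - U\<^sup>2 \<noteq> 0" using ne by (simp add: U_def V_def power2_eq_iff_nonneg)
  ultimately have "Im \<kappa> = 0" by (metis mult_eq_0_iff)
  then obtain r where r: "\<kappa> = of_real r" by (metis complex_is_Real_iff Reals_cases)
  have \<alpha>r: "\<alpha> = r * (U\<^sup>2 + V\<^sup>2)"
    using arg_cong[OF \<alpha>, of Re] by (simp add: r algebra_simps del: of_real_power)
  have "cnj C * u * v = of_real r * ((u * cnj u) * (v * cnj v))" by (simp add: C r mult_ac)
  then have "Re (cnj C * u * v) = r * (U\<^sup>2 * V\<^sup>2)"
    unfolding nu nv by (simp flip: of_real_mult)
  moreover have "(cmod C)\<^sup>2 = r\<^sup>2 * (U\<^sup>2 * V\<^sup>2)"
    by (simp add: C r norm_mult power_mult_distrib U_def V_def)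
  ultimately have "r * (U\<^sup>2 - V\<^sup>2)\<^sup>2 * r = r * (U\<^sup>2 - V\<^sup>2)\<^sup>2 * 1"
    using size unfolding U_def[symmetric] V_def[symmetric] \<alpha>r by (simp add: power2_eq_square algebra_simps)
  moreover have "r \<noteq> 0" using pos \<alpha>r by auto
  moreover have "(U\<^sup>2 - V\<^sup>2)\<^sup>2 \<noteq> 0" using ne by (simp add: U_def V_def power2_eq_iff_nonneg)
  ultimately have "r = 1" by (metis mult_left_cancel mult_eq_0_iff)
  then show ?thesis by (simp add: C r)
qed

text \<open>
  The equation of the ellipse, pulled back to the equilateral triangle, must be a multiple of the
  equation of the incircle. The vanishing of its linear part places the centre at \<open>g\<close>, and the remaining
  conditions determine the focal parameter.
\<close>
lemma focal_ellipse_touching_sides: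
  assumes ne: "cmod u \<noteq> cmod v" and s: "dist f1 f2 < s"
    and tan: "\<And>\<zeta>. \<zeta> \<in> {1, omega, cnj omega} \<Longrightarrow>
      tangent_to_side_at_midpoint {z. dist z f1 + dist z f2 = s}
        (real_affine g u v (omega * \<zeta>)) (real_affine g u v (cnj omega * \<zeta>))"
  shows "midpoint f1 f2 = g" "((f1 - f2) / 2)\<^sup>2 = u * v"
proof -
  define h c where "h = midpoint f1 f2" and "c = (f1 - f2) / 2"
  define C \<alpha> where "C = c\<^sup>2" and "\<alpha> = s\<^sup>2 - 2 * cmod C"
  define N where "N = s\<^sup>2 * (s\<^sup>2 - 4 * cmod C) / 4"
  define e where "e = g - h"
  have f: "f1 = h + c" "f2 = h - c"
    by (simp_all add: h_def c_def midpoint_def scaleR_conv_of_real field_simps)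
  have "2 * cmod c < s" using s by (simp add: f dist_norm norm_mult flip: mult_2)
  then have "(2 * cmod c)\<^sup>2 < s\<^sup>2" by (intro power_strict_mono) auto
  then have \<alpha>C: "2 * cmod C < \<alpha>" by (simp add: \<alpha>_def C_def norm_power power_mult_distrib)
  then have "\<alpha> > 0" using norm_ge_zero[of C] by linarith
  have on: "polar_form \<alpha> C (z - h) (z - h) = N" if "z \<in> {z. dist z f1 + dist z f2 = s}" for z
  proof -
    have "cmod ((z - h) - c) + cmod ((z - h) + c) = s"
      using that by (simp add: f dist_norm algebra_simps)
    then show ?thesis unfolding \<alpha>_def C_def N_def by (rule focal_sum_imp_quadratic)
  qed
  have shift: "real_affine g u v x - h = real_affine e u v x" for x
    by (simp add: real_affine_def e_def)
  define S where "S = u * polar_gradient \<alpha> C e + cnj v * cnj (polar_gradient \<alpha> C e)"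
  define \<rho> where "\<rho> = \<alpha> * ((cmod u)\<^sup>2 + (cmod v)\<^sup>2) - 4 * Re (cnj C * u * v)"
  define \<delta> where "\<delta> = 2 * (of_real \<alpha> * u * cnj v - cnj C * u\<^sup>2 - C * (cnj v)\<^sup>2)"
  have val: "polar_form \<alpha> C e e - N + 2 * Re (S * (- \<zeta> / 2)) + \<rho> * (cmod (- \<zeta> / 2))\<^sup>2
      + Re (\<delta> * (- \<zeta> / 2)\<^sup>2) = 0"
    and der: "Re (S * (\<i> * \<zeta>)) + \<rho> * Re (cnj (- \<zeta> / 2) * (\<i> * \<zeta>))
      + Re (\<delta> * (- \<zeta> / 2 * (\<i> * \<zeta>))) = 0"
    if \<zeta>: "\<zeta> \<in> {1, omega, cnj omega}" for \<zeta>
  proof -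
    note t = tangent_line_at_quadratic_curve[OF _ on, OF tan[OF \<zeta>, unfolded tangent_to_side_at_midpoint_def],
        unfolded midpoint_real_affine shift]
    show "polar_form \<alpha> C e e - N + 2 * Re (S * (- \<zeta> / 2)) + \<rho> * (cmod (- \<zeta> / 2))\<^sup>2
      + Re (\<delta> * (- \<zeta> / 2)\<^sup>2) = 0"
      using t(1) unfolding polar_form_real_affine S_def \<rho>_def \<delta>_def by linarith
    have "real_affine g u v (cnj omega * \<zeta>) - real_affine g u v (omega * \<zeta>)
        = (- sqrt 3) *\<^sub>R real_affine 0 u v (\<i> * \<zeta>)"
      using side_direction_real_affine[of g u v \<zeta>] by (simp add: algebra_simps)
    then have "- sqrt 3 * polar_form \<alpha> C (real_affine e u v (- \<zeta> / 2)) (real_affine 0 u v (\<i> * \<zeta>)) = 0"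
      using t(2) unfolding polar_form_scaleR_right[symmetric] by (simp only:)
    then have "polar_form \<alpha> C (real_affine e u v (- \<zeta> / 2)) (real_affine 0 u v (\<i> * \<zeta>)) = 0" by simp
    then show "Re (S * (\<i> * \<zeta>)) + \<rho> * Re (cnj (- \<zeta> / 2) * (\<i> * \<zeta>))
      + Re (\<delta> * (- \<zeta> / 2 * (\<i> * \<zeta>))) = 0"
      unfolding polar_form_real_affine_direction S_def \<rho>_def \<delta>_def .
  qed
  have q: "S = 0" "\<delta> = 0" "polar_form \<alpha> C e e - N = - \<rho> / 4"
    using quadratic_touching_equilateral_triangle[OF val der] by blast+
  \<comment> \<open>Since \<open>S = 0\<close>, invertibility of the linear part forces the gradient to vanish.\<close>
  have "polar_gradient \<alpha> C e = 0"
  proof (rule ccontr)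
    assume "polar_gradient \<alpha> C e \<noteq> 0"
    moreover have "cmod (u * polar_gradient \<alpha> C e) = cmod (cnj v * cnj (polar_gradient \<alpha> C e))"
      using q(1) unfolding S_def by (metis add_eq_0_iff norm_minus_cancel)
    ultimately show False using ne by (simp add: norm_mult)
  qed
  then have "e = 0" using \<alpha>C by (rule polar_gradient_eq_0)
  then show "midpoint f1 f2 = g" by (simp add: e_def h_def)
  \<comment> \<open>Comparison of the constant terms: \<open>s\<^sup>2 = \<alpha> + 2 |C|\<close> and \<open>s\<^sup>2 - 4 |C| = \<alpha> - 2 |C|\<close>.\<close>
  have "4 * N = (\<alpha> + 2 * cmod C) * (\<alpha> - 2 * cmod C)" by (simp add: N_def \<alpha>_def)
  then have "\<alpha>\<^sup>2 - 4 * (cmod C)\<^sup>2 = \<rho>"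
    using q(3) \<open>e = 0\<close> by (simp add: polar_form_def power2_eq_square algebra_simps)
  moreover have "of_real \<alpha> * u * cnj v = cnj C * u\<^sup>2 + C * (cnj v)\<^sup>2"
  proof -
    have "of_real \<alpha> * u * cnj v - cnj C * u\<^sup>2 - C * (cnj v)\<^sup>2 = 0"
      using q(2) unfolding \<delta>_def by (metis mult_eq_0_iff zero_neq_numeral)
    then show ?thesis by (simp only: diff_diff_eq right_minus_eq)
  qed
  ultimately have "C = u * v"
    using focal_parameter_unique[OF ne \<open>\<alpha> > 0\<close>] by (simp add: \<rho>_def)
  then show "((f1 - f2) / 2)\<^sup>2 = u * v" by (simp add: C_def c_def)
qed

lemma foci_eq_of_midpoint_of_square:
  assumes "midpoint f1 f2 = g" "((f1 - f2) / 2)\<^sup>2 = c\<^sup>2"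
  shows "f1 = g + c \<and> f2 = g - c \<or> f1 = g - c \<and> f2 = (g + c :: complex)"
proof -
  have "(f1 - f2) / 2 = c \<or> (f1 - f2) / 2 = - c" using assms(2) by (simp only: power2_eq_iff)
  moreover have "f1 = g + (f1 - f2) / 2" "f2 = g - (f1 - f2) / 2"
    unfolding assms(1)[symmetric] by (simp_all add: midpoint_def scaleR_conv_of_real field_simps)
  ultimately show ?thesis by (metis diff_minus_eq_add uminus_add_conv_diff add.commute)
qed

section \<open>Critical points and foci\<close>

text \<open>
  In the coordinate \<open>x = z - g\<close> the polynomial is a multiple of \<open>x\<^sup>3 - 3 u v x - (u\<^sup>3 + v\<^sup>3)\<close>, with
  derivative \<open>3 (x\<^sup>2 - u v)\<close>.
\<close>
lemma critical_points_real_affine: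
  fixes a b :: complex
  defines "u \<equiv> a\<^sup>2" and "v \<equiv> b\<^sup>2"
  assumes p: "degree p = 3"
    "proots p = {#real_affine g u v 1, real_affine g u v omega, real_affine g u v (cnj omega)#}"
  shows "critical_points p = {#g + a * b, g - a * b#}"
proof -
  let ?z1 = "real_affine g u v 1" and ?z2 = "real_affine g u v omega"
    and ?z3 = "real_affine g u v (cnj omega)"
  have lc: "lead_coeff p \<noteq> 0" using p(1) by (metis degree_0 leading_coeff_0_iff zero_neq_numeral)
  have w: "cnj omega = - 1 - omega" using omega_sum by (simp add: algebra_simps eq_neg_iff_add_eq_0)
  have e1: "?z1 + ?z2 + ?z3 = 3 * g"
  proof -
    have "?z1 + ?z2 + ?z3 = 3 * g + (u + v) * (1 + omega + cnj omega)"
      by (simp add: real_affine_def algebra_simps)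
    then show ?thesis by (simp add: omega_sum)
  qed
  have e2: "?z1 * ?z2 + ?z2 * ?z3 + ?z3 * ?z1 = 3 * ((g + a * b) * (g - a * b))"
  proof -
    have "(u * omega + v * cnj omega) * (u * cnj omega + v * omega) = u\<^sup>2 + v\<^sup>2 - u * v"
    proof -
      have "(u * omega + v * cnj omega) * (u * cnj omega + v * omega) 
         = (u\<^sup>2 + v\<^sup>2) * (omega * cnj omega) + u * v * (omega\<^sup>2 + (cnj omega)\<^sup>2)"
        by (simp add: power2_eq_square algebra_simps)
      also have "omega\<^sup>2 + (cnj omega)\<^sup>2 = - 1"
        by (simp add: omega_def complex_eq_iff power2_eq_square field_simps)
      finally show ?thesis by (simp add: omega_cnj)
    qed
    moreover have "u * omega + v * cnj omega + (u * cnj omega + v * omega) = - u - v"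
      unfolding w by (simp add: algebra_simps)
    moreover have "u * v = (a * b) * (a * b)" by (simp add: u_def v_def power2_eq_square)
    moreover define X Y where "X = u * omega + v * cnj omega" "Y = u * cnj omega + v * omega"
    moreover have "?z1 = g + u + v" "?z2 = g + X" "?z3 = g + Y"
      by (simp_all add: real_affine_def X_Y_def)
    ultimately show ?thesis by (simp add: power2_eq_square) algebra
  qed
  have "p = smult (lead_coeff p) ([:- ?z1, 1:] * [:- ?z2, 1:] * [:- ?z3, 1:])"
    using complex_poly_decompose_multiset[of p] unfolding p(2)
    by (simp only: image_mset_add_mset image_mset_empty prod_mset.add_mset prod_mset.empty
        mult_1_right mult.assoc)
  also have "[:- ?z1, 1:] * [:- ?z2, 1:] * [:- ?z3, 1:]
      = [:- (?z1 * ?z2 * ?z3), ?z1 * ?z2 + ?z2 * ?z3 + ?z3 * ?z1, - (?z1 + ?z2 + ?z3), 1:]"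
    by (simp add: algebra_simps)
  finally have "pderiv p = smult (lead_coeff p) 
      (pderiv [:- (?z1 * ?z2 * ?z3), 3 * ((g + a * b) * (g - a * b)), - (3 * g), 1:])"
    unfolding e1 e2 by (metis pderiv_smult)
  also have "\<dots> = smult (3 * lead_coeff p) ([:- (g + a * b), 1:] * [:- (g - a * b), 1:])"
    by (simp add: pderiv_pCons algebra_simps)
  finally have "proots (pderiv p) = proots ([:- (g + a * b), 1:] * [:- (g - a * b), 1:])"
    using lc by (metis mult_eq_0_iff proots_smult zero_neq_numeral)
  also have "\<dots> = proots [:- (g + a * b), 1:] + proots [:- (g - a * b), 1:]"
    by (rule proots_mult) auto
  also have "\<dots> = {#g + a * b, g - a * b#}"
    unfolding proots_linear_factor by simp
  finally show ?thesis by (simp add: critical_points_def)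
qed

theorem theorem13:
  fixes p :: "complex poly" and z1 z2 z3 :: complex
  assumes "degree p = 3"
    and "proots p = {#z1, z2, z3#}"
    and "\<not> collinear {z1, z2, z3}"
  shows "(\<exists>!E. midpoint_inscribed_ellipse E z1 z2 z3) \<and>
    (\<forall>E. midpoint_inscribed_ellipse E z1 z2 z3 \<longrightarrow>
       (\<forall>F. ellipse_with_foci E F \<longleftrightarrow> F = critical_points p))"
proof -
  obtain g u v where z: "z1 = real_affine g u v 1" "z2 = real_affine g u v omega"
      "z3 = real_affine g u v (cnj omega)"
    by (rule triangle_eq_real_affine_image)
  have ne: "cmod u \<noteq> cmod v" using assms(3) unfolding z by (rule noncollinear_imp_norm_neq)
  define a b where "a = csqrt u" and "b = csqrt v"
  have ab: "u = a\<^sup>2" "v = b\<^sup>2" by (simp_all add: a_def b_def)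
  define E0 where "E0 = real_affine g u v ` sphere 0 (1 / 2)"
  have crit: "critical_points p = {#g + a * b, g - a * b#}"
    using critical_points_real_affine[of p g a b] assms(1,2) unfolding z ab by blast
  have E0: "E0 = {z. dist z (g + a * b) + dist z (g - a * b) = cmod u + cmod v}"
    using focal_ellipse_eq_real_affine_circle[of a b g] ne unfolding E0_def ab by simp
  have "dist (g + a * b) (g - a * b) < cmod u + cmod v"
  proof -
    have "0 < (cmod a - cmod b)\<^sup>2" using ne by (auto simp: ab norm_power)
    then have "2 * (cmod a * cmod b) < cmod u + cmod v"
      by (simp add: ab norm_mult power2_eq_square algebra_simps)
    then show ?thesis by (simp add: dist_norm norm_mult flip: mult_2)
  qed
  then have foci: "ellipse_with_foci E0 (critical_points p)"
    unfolding ellipse_with_foci_def crit using E0 by blast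
  have inscribed: "midpoint_inscribed_ellipse E0 z1 z2 z3"
    unfolding z midpoint_inscribed_ellipse_real_affine
  proof (intro conjI ballI)
    show "is_ellipse E0" using foci by (auto simp: is_ellipse_def)
    show "E0 \<subseteq> convex hull {real_affine g u v 1, real_affine g u v omega, real_affine g u v (cnj omega)}"
      unfolding E0_def by (auto intro!: real_affine_disc_subset_triangle)
    show "tangent_to_side_at_midpoint E0 (real_affine g u v (omega * \<zeta>)) (real_affine g u v (cnj omega * \<zeta>))"
      if "\<zeta> \<in> {1, omega, cnj omega}" for \<zeta>
      unfolding E0_def using that norm_omega by (intro tangent_to_sides_at_midpoints[OF ne]) auto
  qed
  have unique: "E = E0 \<and> F = critical_points p"
    if E: "midpoint_inscribed_ellipse E z1 z2 z3" and F: "ellipse_with_foci E F" for E F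
  proof -
    obtain f1 f2 s where F': "F = {#f1, f2#}" and s: "dist f1 f2 < s"
      and E': "E = {z. dist z f1 + dist z f2 = s}"
      using F unfolding ellipse_with_foci_def by blast
    have tan: "tangent_to_side_at_midpoint {z. dist z f1 + dist z f2 = s}
        (real_affine g u v (omega * \<zeta>)) (real_affine g u v (cnj omega * \<zeta>))"
      if "\<zeta> \<in> {1, omega, cnj omega}" for \<zeta>
      using E that unfolding z midpoint_inscribed_ellipse_real_affine E' by blast
    have "midpoint f1 f2 = g" "((f1 - f2) / 2)\<^sup>2 = (a * b)\<^sup>2"
      using focal_ellipse_touching_sides[OF ne s tan] by (simp_all add: ab power_mult_distrib)
    then have f: "f1 = g + a * b \<and> f2 = g - a * b \<or> f1 = g - a * b \<and> f2 = g + a * b"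
      by (rule foci_eq_of_midpoint_of_square)
    have in_curve: "midpoint z1 z2 \<in> X" if "midpoint_inscribed_ellipse X z1 z2 z3" for X
      using that
      unfolding midpoint_inscribed_ellipse_def tangent_to_side_at_midpoint_def tangent_line_at_def
      by (auto dest: eventually_nhds_x_imp_x)
    \<comment> \<open>Both curves pass through the midpoint of the first side, so equal foci give equal sums.\<close>
    have "s = cmod u + cmod v"
      using in_curve[OF E] in_curve[OF inscribed] f unfolding E0 E' by auto
    then have "E = E0" unfolding E' E0 using f by (auto simp: add.commute)
    moreover have "F = critical_points p" unfolding F' crit using f by (auto simp: add_mset_commute)
    ultimately show ?thesis ..
  qed
  have all: "E = E0" if "midpoint_inscribed_ellipse E z1 z2 z3" for E
    using that unique unfolding midpoint_inscribed_ellipse_def is_ellipse_def by blast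
  have "ellipse_with_foci E F \<longleftrightarrow> F = critical_points p"
    if "midpoint_inscribed_ellipse E z1 z2 z3" for E F
    using all[OF that] unique[OF that] foci by metis
  with inscribed all show ?thesis by blast
qed

end
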